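(* Let $f_1\in\mathcal F_{\mu_1,L_1}$ and $f_2\in\mathcal F_{\mu_2,L_2}$ be functions on $\mathbb R^d$ satisfying the standing assumption (A) of the context, and let $F=f_1-f_2$. Assume $\mu_1+\mu_2>0$. Let $N\ge 1$ and let $x^0,x^1,\dots,x^{N+1}$ be generated by $N+1$ iterations of DCA started from $x^0\in\operatorname{dom}\partial f_1$. Then $$\frac12\min_{0\le k\le N}\|x^k-x^{k+1}\|^2\;\le\;\frac{F(x^0)-F(x^{N+1})}{(\mu_1+\mu_2)+p_i(\mu_1,L_1,\mu_2,L_2)\,N}$$ holds for each $i\in\{1,\dots,6\}$ such that the parameters lie in the $i$-th of the following domains, with $p_i$ given by: 1. If $\mu_1\ge\mu_2\ge 0$ and $L_2>\mu_1$: $\;p_1=\mu_1+\mu_2+\frac{(\mu_1-\mu_2)^2}{L_2-\mu_2}$. 2. If $\mu_2\ge\mu_1\ge 0$ and $L_1>\mu_2$: $\;p_2=\mu_1+\mu_2+\frac{(\mu_1-\mu_2)^2}{L_1-\mu_1}$. 3. If $\mu_2\in\big[\frac{-L_2\mu_1}{L_2+\mu_1},0\big)$ and $L_2>\mu_1>0$: $\;p_3=\frac{(\mu_1+\mu_2)(L_2+\mu_1)}{L_2+\mu_2}$. 4. If $\mu_2\in\big[\frac{-L_2\mu_1}{L_2+\mu_1},L_2\big)$ and $L_2\in[0,\mu_1]$: $\;p_4=\frac{\mu_1^2(L_2+\mu_1)}{L_2^2}$. 5. If $\mu_2<0$ and $\mu_2\in\big(-\mu_1,\frac{-L_2\mu_1}{L_2+\mu_1}\big]$: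 $\;p_5=\frac{\mu_1^2(\mu_1+\mu_2)}{\mu_2^2}$. 6. If $\mu_2\ge\mu_1\ge 0$ and $L_1\in(0,\mu_2]$: $\;p_6=\frac{\mu_2^2(L_1+\mu_2)}{L_1^2}$.
   Context: Function class. For $\mu\in\mathbb R$ and $L\in(\mu,\infty]$, $\mathcal F_{\mu,L}$ denotes the set of proper, lower semicontinuous functions $f:\mathbb R^d\to\mathbb R\cup\{+\infty\}$ such that $f-\frac{\mu}{2}\|\cdot\|^2$ is convex and, if $L<\infty$, $f$ is finite-valued and $\frac L2\|\cdot\|^2-f$ is convex (no condition on the upper curvature if $L=\infty$). Expressions in which some $L_i=\infty$ are understood as limits $L_i\to\infty$. Subdifferential. For convex $f$, $\partial f(x)$ is the usual convex subdifferential. For $f\in\mathcal F_{\mu,L}$ with $\mu<0$, $\partial f(x):=\partial\tilde f(x)+\mu x$ where $\tilde f=f-\frac\mu2\|\cdot\|^2$ is convex. $\operatorname{dom}\partial f=\{x:\partial f(x)\ne\emptyset\}$ and $\operatorname{range}\partial f=\bigcup_x\partial f(x)$. Standing assumption (A). $f_1\in\mathcal F_{\mu_1,L_1}$ and $f_2\in\mathcal F_{\mu_2,L_2}$ with $0\le\mu_1<L_1\le\infty$, $\mu_2\in(-\infty,\infty)$, $L_2\in(\mu_2,\infty]$; $F=f_1-f_2$ (with the convention $(+\infty)-(+\infty)=+\infty$) is bounded below; $\emptyset\ne\operatorname{dom}\partial f_1\subseteq\operatorname{dom}\partial f_2$ and $\operatorname{range}\partial f_2\subseteq\operatorname{range}\partial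 f_1$. DCA (difference-of-convex algorithm). Given $x^k$, one iteration selects any $g_2^k\in\partial f_2(x^k)$ and any $x^{k+1}\in\arg\min_{w\in\mathbb R^d}\{f_1(w)-\langle g_2^k,w\rangle\}$. *)

theory Defs
  imports "HOL-Analysis.Analysis"
begin

definition proper_fun :: "('a \<Rightarrow> ereal) \<Rightarrow> bool" where
  "proper_fun f \<longleftrightarrow> (\<forall>x. f x \<noteq> -\<infinity>) \<and> (\<exists>x. f x \<noteq> \<infinity>)"

definition lsc_fun :: "('a::topological_space \<Rightarrow> ereal) \<Rightarrow> bool" where
  "lsc_fun f \<longleftrightarrow> (\<forall>x. f x \<le> Liminf (at x) f)"

(* convex_on covers real-valued functions only.  The weights are kept in the open
   interval (0,1), so no product 0 * \<infinity> occurs. *)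
definition convex_fun :: "('a::real_vector \<Rightarrow> ereal) \<Rightarrow> bool" where
  "convex_fun f \<longleftrightarrow>
     (\<forall>x y. \<forall>t\<in>{0<..<1::real}.
        f ((1 - t) *\<^sub>R x + t *\<^sub>R y) \<le> ereal (1 - t) * f x + ereal t * f y)"

definition shift_quad :: "real \<Rightarrow> ('a::real_normed_vector \<Rightarrow> ereal) \<Rightarrow> 'a \<Rightarrow> ereal" where
  "shift_quad \<mu> f x = f x - ereal (\<mu> / 2 * (norm x)\<^sup>2)"

definition curv_class :: "real \<Rightarrow> ereal \<Rightarrow> ('a::euclidean_space \<Rightarrow> ereal) set" where
  "curv_class \<mu> L =
     {f. proper_fun f \<and> lsc_fun f \<and> convex_fun (shift_quad \<mu> f) \<and>
         (L < \<infinity> \<longrightarrow>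
            (\<forall>x. \<bar>f x\<bar> \<noteq> \<infinity>) \<and>
            convex_on UNIV (\<lambda>x. real_of_ereal L / 2 * (norm x)\<^sup>2 - real_of_ereal (f x)))}"

(* Only used for proper f, for which the set is empty wherever f x = \<infinity>. *)
definition convex_subdiff :: "('a::real_inner \<Rightarrow> ereal) \<Rightarrow> 'a \<Rightarrow> 'a set" where
  "convex_subdiff f x = {g. \<forall>y. f x + ereal (g \<bullet> (y - x)) \<le> f y}"

definition subdiff :: "real \<Rightarrow> ('a::real_inner \<Rightarrow> ereal) \<Rightarrow> 'a \<Rightarrow> 'a set" where
  "subdiff \<mu> f x =
     (if \<mu> < 0 then (\<lambda>g. g + \<mu> *\<^sub>R x) ` convex_subdiff (shift_quad \<mu> f) x
      else convex_subdiff f x)"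

definition dom_subdiff :: "real \<Rightarrow> ('a::real_inner \<Rightarrow> ereal) \<Rightarrow> 'a set" where
  "dom_subdiff \<mu> f = {x. subdiff \<mu> f x \<noteq> {}}"

definition range_subdiff :: "real \<Rightarrow> ('a::real_inner \<Rightarrow> ereal) \<Rightarrow> 'a set" where
  "range_subdiff \<mu> f = (\<Union>x. subdiff \<mu> f x)"

(* Subtraction on ereal satisfies \<infinity> - \<infinity> = \<infinity>, which is the intended convention here. *)
definition dc_obj :: "('a \<Rightarrow> ereal) \<Rightarrow> ('a \<Rightarrow> ereal) \<Rightarrow> 'a \<Rightarrow> ereal" where
  "dc_obj f1 f2 x = f1 x - f2 x"

definition dc_standing ::
  "real \<Rightarrow> ereal \<Rightarrow> real \<Rightarrow> ereal \<Rightarrow>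
   ('a::euclidean_space \<Rightarrow> ereal) \<Rightarrow> ('a \<Rightarrow> ereal) \<Rightarrow> bool" where
  "dc_standing \<mu>1 L1 \<mu>2 L2 f1 f2 \<longleftrightarrow>
     0 \<le> \<mu>1 \<and> ereal \<mu>1 < L1 \<and> ereal \<mu>2 < L2 \<and>
     f1 \<in> curv_class \<mu>1 L1 \<and> f2 \<in> curv_class \<mu>2 L2 \<and>
     (\<exists>m::real. \<forall>x. ereal m \<le> dc_obj f1 f2 x) \<and>
     dom_subdiff \<mu>1 f1 \<noteq> {} \<and>
     dom_subdiff \<mu>1 f1 \<subseteq> dom_subdiff \<mu>2 f2 \<and>
     range_subdiff \<mu>2 f2 \<subseteq> range_subdiff \<mu>1 f1"

definition dca_step ::
  "('a::euclidean_space \<Rightarrow> ereal) \<Rightarrow> real \<Rightarrow> ('a \<Rightarrow> ereal) \<Rightarrow> 'a \<Rightarrow> 'a \<Rightarrow> bool" where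
  "dca_step f1 \<mu>2 f2 x x' \<longleftrightarrow>
     (\<exists>g\<in>subdiff \<mu>2 f2 x. is_arg_min (\<lambda>w. f1 w - ereal (g \<bullet> w)) (\<lambda>_. True) x')"

definition at_ext :: "(real \<Rightarrow> real) \<Rightarrow> ereal \<Rightarrow> real" where
  "at_ext h L = (if L = \<infinity> then Lim at_top h else h (real_of_ereal L))"

definition dca_threshold :: "real \<Rightarrow> ereal \<Rightarrow> real" where
  "dca_threshold \<mu>1 L2 = at_ext (\<lambda>l. - l * \<mu>1 / (l + \<mu>1)) L2"

(* The denominator l + \<mu>1 can only vanish for L2 = \<mu>1 = 0 (i = 4), where the
   interval for \<mu>2 is empty. *)
definition dca_regime :: "nat \<Rightarrow> real \<Rightarrow> ereal \<Rightarrow> real \<Rightarrow> ereal \<Rightarrow> bool" where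
  "dca_regime i \<mu>1 L1 \<mu>2 L2 \<longleftrightarrow>
     (i = 1 \<and> \<mu>1 \<ge> \<mu>2 \<and> \<mu>2 \<ge> 0 \<and> L2 > ereal \<mu>1) \<or>
     (i = 2 \<and> \<mu>2 \<ge> \<mu>1 \<and> \<mu>1 \<ge> 0 \<and> L1 > ereal \<mu>2) \<or>
     (i = 3 \<and> dca_threshold \<mu>1 L2 \<le> \<mu>2 \<and> \<mu>2 < 0 \<and> L2 > ereal \<mu>1 \<and> \<mu>1 > 0) \<or>
     (i = 4 \<and> dca_threshold \<mu>1 L2 \<le> \<mu>2 \<and> ereal \<mu>2 < L2 \<and> 0 \<le> L2 \<and> L2 \<le> ereal \<mu>1) \<or>
     (i = 5 \<and> \<mu>2 < 0 \<and> -\<mu>1 < \<mu>2 \<and> \<mu>2 \<le> dca_threshold \<mu>1 L2) \<or>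
     (i = 6 \<and> \<mu>2 \<ge> \<mu>1 \<and> \<mu>1 \<ge> 0 \<and> 0 < L1 \<and> L1 \<le> ereal \<mu>2)"

definition dca_coeff :: "nat \<Rightarrow> real \<Rightarrow> ereal \<Rightarrow> real \<Rightarrow> ereal \<Rightarrow> real" where
  "dca_coeff i \<mu>1 L1 \<mu>2 L2 =
     (if i = 1 then at_ext (\<lambda>l. \<mu>1 + \<mu>2 + (\<mu>1 - \<mu>2)\<^sup>2 / (l - \<mu>2)) L2
      else if i = 2 then at_ext (\<lambda>l. \<mu>1 + \<mu>2 + (\<mu>1 - \<mu>2)\<^sup>2 / (l - \<mu>1)) L1
      else if i = 3 then at_ext (\<lambda>l. (\<mu>1 + \<mu>2) * (l + \<mu>1) / (l + \<mu>2)) L2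
      else if i = 4 then at_ext (\<lambda>l. \<mu>1\<^sup>2 * (l + \<mu>1) / l\<^sup>2) L2
      else if i = 5 then \<mu>1\<^sup>2 * (\<mu>1 + \<mu>2) / \<mu>2\<^sup>2
      else if i = 6 then at_ext (\<lambda>l. \<mu>2\<^sup>2 * (l + \<mu>2) / l\<^sup>2) L1
      else 0)"

end

theory Submission
  imports Defs "HOL-Real_Asymp.Real_Asymp"
begin

text \<open>
  Write \<open>a\<close> for a step, \<open>b\<close> for the next one and \<open>d\<close> for the difference of the subgradients
  chosen in them.  Strong monotonicity of \<open>\<partial>f1\<close> gives \<open>d \<bullet> b \<ge> \<mu>1 |b|\<^sup>2\<close>,
  so if every step has length at least \<open>m\<close> then \<open>|a| \<ge> m\<close> and \<open>|d| \<ge> \<mu>1 m\<close>.  Interpolation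
  for \<open>f2\<close> bounds twice the decrease of \<open>F\<close> from below by
  \<open>(\<mu>1 + \<mu>2) |a|\<^sup>2 + |d - \<mu>2 a|\<^sup>2 / (L2 - \<mu>2)\<close>, and minimising this expression
  subject to \<open>|e|\<^sup>2 \<le> (L2 - \<mu>2) (e \<bullet> a)\<close> for \<open>e = d - \<mu>2 a\<close> (cocoercivity) yields
  \<open>p\<^sub>i m\<^sup>2\<close> in the regimes 1, 3, 4 and 5.  Regimes 2 and 6 are regimes 1 and 4
  with the roles of \<open>f1\<close> and \<open>f2\<close> exchanged, the gain then occurring in the second of the two
  steps.  The one step without a neighbour contributes \<open>\<mu>1 + \<mu>2\<close>.
\<close>

section \<open>Norm expansion and a limit argument\<close>

lemma norm_add_scaleR_sq:
  fixes x y :: "'a::real_inner"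
  shows "(norm (x + t *\<^sub>R y))\<^sup>2 = (norm x)\<^sup>2 + 2 * t * (x \<bullet> y) + t\<^sup>2 * (norm y)\<^sup>2"
  unfolding power2_norm_eq_inner
  by (simp add: inner_simps inner_commute power2_eq_square algebra_simps)

text \<open>Let \<open>t\<close> tend to 0 from the right. In the uses below, \<open>t * c\<close>
  is the second-order remainder left after dividing an inequality along a segment by
  \<open>t\<close>.\<close>

lemma le_of_le_add_small_multiple:
  fixes a b c :: real
  assumes "\<And>t. 0 < t \<Longrightarrow> t < 1 \<Longrightarrow> a \<le> b + t * c"
  shows "a \<le> b"
proof (rule tendsto_lowerbound)
  show "((\<lambda>t. b + t * c) \<longlongrightarrow> b) (at_right 0)"
    by real_asymp
  show "\<forall>\<^sub>F t in at_right 0. a \<le> b + t * c"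
    using assms eventually_at_right_real[of 0 1] by (auto elim!: eventually_mono)
qed simp

section \<open>Finiteness and quadratic lower bounds at subgradients\<close>

lemma convex_subdiff_finite:
  assumes "proper_fun f" "g \<in> convex_subdiff f x"
  shows "\<bar>f x\<bar> \<noteq> \<infinity>"
proof -
  obtain y where y: "f y \<noteq> \<infinity>"
    using assms(1) unfolding proper_fun_def by blast
  have "f x + ereal (g \<bullet> (y - x)) \<le> f y"
    using assms(2) unfolding convex_subdiff_def by blast
  then have "f x \<noteq> \<infinity>"
    using y by (cases "f y") auto
  then show ?thesis
    using assms(1) unfolding proper_fun_def by auto
qed

lemma proper_fun_shift_quad: "proper_fun f \<Longrightarrow> proper_fun (shift_quad \<mu> f)"
proof -
  assume "proper_fun f"
  moreover have "f x - ereal c = \<infinity> \<longleftrightarrow> f x = \<infinity>" "f x - ereal c = -\<infinity> \<longleftrightarrow> f x = -\<infinity>" for x c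
    by (cases "f x"; simp)+
  ultimately show "proper_fun (shift_quad \<mu> f)"
    unfolding proper_fun_def shift_quad_def by simp
qed

lemma subdiff_finite:
  assumes "f \<in> curv_class \<mu> L" "g \<in> subdiff \<mu> f x"
  shows "\<bar>f x\<bar> \<noteq> \<infinity>"
proof (cases "\<mu> < 0")
  case True
  have "proper_fun (shift_quad \<mu> f)"
    using assms(1) by (simp add: curv_class_def proper_fun_shift_quad)
  moreover obtain g' where "g' \<in> convex_subdiff (shift_quad \<mu> f) x"
    using assms(2) True by (auto simp: subdiff_def)
  ultimately have "\<bar>shift_quad \<mu> f x\<bar> \<noteq> \<infinity>"
    by (rule convex_subdiff_finite)
  then show ?thesis
    by (cases "f x") (auto simp: shift_quad_def)
next
  case False
  then show ?thesis
    using assms convex_subdiff_finite[of f g x] by (simp add: curv_class_def subdiff_def)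
qed

text \<open>For \<open>\<mu> < 0\<close> this is the definition of \<open>subdiff\<close> with the
  shift expanded. Otherwise the subgradient inequality lacks the quadratic term; it is recovered by
  applying that inequality at \<open>x + t *\<^sub>R (y - x)\<close>, bounding the value there by
  convexity of the shifted function, dividing by \<open>t\<close> and letting \<open>t\<close> tend
  to 0.\<close>

lemma subdiff_quadratic_lower_bound:
  fixes f :: "'a::euclidean_space \<Rightarrow> ereal"
  assumes f: "f \<in> curv_class \<mu> L" and g: "g \<in> subdiff \<mu> f x"
    and fx: "f x = ereal r" and fy: "f y = ereal s"
  shows "r + g \<bullet> (y - x) + \<mu> / 2 * (norm (y - x))\<^sup>2 \<le> s"
proof (cases "\<mu> < 0")
  case True
  then obtain g' where g': "g' \<in> convex_subdiff (shift_quad \<mu> f) x" "g = g' + \<mu> *\<^sub>R x"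
    using g by (auto simp: subdiff_def)
  then have "shift_quad \<mu> f x + ereal (g' \<bullet> (y - x)) \<le> shift_quad \<mu> f y"
    by (simp add: convex_subdiff_def)
  then have "r - \<mu> / 2 * (norm x)\<^sup>2 + g' \<bullet> (y - x) \<le> s - \<mu> / 2 * (norm y)\<^sup>2"
    by (simp add: shift_quad_def fx fy)
  then show ?thesis
    unfolding g'(2)
    by (simp add: power2_norm_eq_inner inner_simps inner_commute algebra_simps)
next
  case False
  then have sub: "f x + ereal (g \<bullet> (z - x)) \<le> f z" for z
    using g by (simp add: subdiff_def convex_subdiff_def)
  define v where "v = y - x"
  have y: "y = x + v"
    by (simp add: v_def)
  have "g \<bullet> v + \<mu> / 2 * (norm v)\<^sup>2 \<le> (s - r) + t * (\<mu> / 2 * (norm v)\<^sup>2)"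
    if t: "0 < t" "t < 1" for t
  proof -
    define z where "z = x + t *\<^sub>R v"
    have z: "(1 - t) *\<^sub>R x + t *\<^sub>R y = z"
      by (simp add: z_def y algebra_simps)
    have cv: "shift_quad \<mu> f z
        \<le> ereal (1 - t) * shift_quad \<mu> f x + ereal t * shift_quad \<mu> f y"
      using f t unfolding curv_class_def convex_fun_def z[symmetric] by auto
    have low: "ereal (r + t * (g \<bullet> v)) \<le> f z"
      using sub[of z] by (simp add: fx z_def)
    \<comment> \<open>\<open>low\<close> excludes the value \<open>-\<infinity>\<close> at
      \<open>z\<close>; \<open>cv\<close> with finite end values excludes
      \<open>\<infinity>\<close>.\<close>
    then obtain w where w: "f z = ereal w"
      using cv by (cases "f z") (auto simp: shift_quad_def fx fy)
    have "w - \<mu> / 2 * (norm z)\<^sup>2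
        \<le> (1 - t) * (r - \<mu> / 2 * (norm x)\<^sup>2) + t * (s - \<mu> / 2 * (norm y)\<^sup>2)"
      using cv by (simp add: shift_quad_def fx fy w)
    moreover have "r + t * (g \<bullet> v) \<le> w"
      using low w by simp
    moreover have "(norm z)\<^sup>2 = (norm x)\<^sup>2 + 2 * t * (x \<bullet> v) + t\<^sup>2 * (norm v)\<^sup>2"
      "(norm y)\<^sup>2 = (norm x)\<^sup>2 + 2 * (x \<bullet> v) + (norm v)\<^sup>2"
      using norm_add_scaleR_sq[of x t v] norm_add_scaleR_sq[of x 1 v]
      by (simp_all add: z_def y)
    moreover have "(1 - t) * (r - \<mu> / 2 * X) + t * (s - \<mu> / 2 * (X + 2 * I + V)) + \<mu> / 2 * (X + 2 * t * I + t\<^sup>2 * V)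
        = r + t * ((s - r) + t * (\<mu> / 2 * V)) - t * (\<mu> / 2 * V)" for X I V
      by (simp add: field_simps power2_eq_square)
    ultimately have "t * (g \<bullet> v) \<le> t * ((s - r) + t * (\<mu> / 2 * (norm v)\<^sup>2)) - t * (\<mu> / 2 * (norm v)\<^sup>2)"
      by (smt (verit))
    then have "t * (g \<bullet> v + \<mu> / 2 * (norm v)\<^sup>2) \<le> t * ((s - r) + t * (\<mu> / 2 * (norm v)\<^sup>2))"
      by (simp add: algebra_simps)
    then show ?thesis
      using t by simp
  qed
  then have "g \<bullet> v + \<mu> / 2 * (norm v)\<^sup>2 \<le> s - r"
    by (rule le_of_le_add_small_multiple)
  then show ?thesis
    by (simp add: v_def)
qed

text \<open>Add the quadratic lower bounds from \<open>x\<close> to \<open>y\<close> and back; the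
  function values cancel.\<close>

lemma subdiff_strongly_monotone:
  assumes "f \<in> curv_class \<mu> L" "g \<in> subdiff \<mu> f x" "h \<in> subdiff \<mu> f y"
  shows "\<mu> * (norm (y - x))\<^sup>2 \<le> (h - g) \<bullet> (y - x)"
proof -
  obtain r s where rs: "f x = ereal r" "f y = ereal s"
    using subdiff_finite[OF assms(1,2)] subdiff_finite[OF assms(1,3)] by fastforce
  show ?thesis
    using subdiff_quadratic_lower_bound[OF assms(1,2) rs]
      subdiff_quadratic_lower_bound[OF assms(1,3) rs(2,1)]
    by (simp add: norm_minus_commute inner_simps algebra_simps)
qed

section \<open>Upper curvature: descent and interpolation\<close>

text \<open>Convexity is applied with \<open>x\<close> between \<open>y\<close> and \<open>x - t (y - x)\<close>, and then \<open>t \<rightarrow> 0\<close>.\<close>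

lemma descent_inequality:
  fixes \<phi> :: "'a::real_inner \<Rightarrow> real"
  assumes cvx: "convex_on UNIV (\<lambda>x. l / 2 * (norm x)\<^sup>2 - \<phi> x)"
    and sub: "\<And>z. \<phi> x + g \<bullet> (z - x) + \<mu> / 2 * (norm (z - x))\<^sup>2 \<le> \<phi> z"
  shows "\<phi> y \<le> \<phi> x + g \<bullet> (y - x) + l / 2 * (norm (y - x))\<^sup>2"
proof -
  define v where "v = y - x"
  have y: "y = x + v"
    by (simp add: v_def)
  have "\<phi> y - \<phi> x - g \<bullet> v - l / 2 * (norm v)\<^sup>2 \<le> 0 + t * ((l - \<mu>) / 2 * (norm v)\<^sup>2)"
    if t: "0 < t" "t < 1" for t
  proof -
    define z where "z = x - t *\<^sub>R v"
    \<comment> \<open>The weight solves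
      \<open>(1 + t) *\<^sub>R x = z + t *\<^sub>R y\<close>.\<close>
    have x: "(1 - t / (1 + t)) *\<^sub>R z + (t / (1 + t)) *\<^sub>R y = x"
    proof -
      have "(1 + t) *\<^sub>R ((1 - t / (1 + t)) *\<^sub>R z + (t / (1 + t)) *\<^sub>R y) = (1 + t) *\<^sub>R x"
        using t by (simp add: z_def y scaleR_add_right field_simps)
      then show ?thesis
        using t by simp
    qed
    have "l / 2 * (norm x)\<^sup>2 - \<phi> x
        \<le> (1 - t / (1 + t)) * (l / 2 * (norm z)\<^sup>2 - \<phi> z) + t / (1 + t) * (l / 2 * (norm y)\<^sup>2 - \<phi> y)"
      using convex_onD[OF cvx, of "t / (1 + t)" z y] t unfolding x by simp
    also have "\<dots> = ((l / 2 * (norm z)\<^sup>2 - \<phi> z) + t * (l / 2 * (norm y)\<^sup>2 - \<phi> y)) / (1 + t)"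
    proof -
      have "1 - t / (1 + t) = 1 / (1 + t)"
        using t by (simp add: field_simps)
      then show ?thesis
        by (simp add: add_divide_distrib)
    qed
    finally have "(1 + t) * (l / 2 * (norm x)\<^sup>2 - \<phi> x)
        \<le> (l / 2 * (norm z)\<^sup>2 - \<phi> z) + t * (l / 2 * (norm y)\<^sup>2 - \<phi> y)"
      using t by (simp add: pos_le_divide_eq mult.commute)
    moreover have "\<phi> x - t * (g \<bullet> v) + \<mu> / 2 * t\<^sup>2 * (norm v)\<^sup>2 \<le> \<phi> z"
      using sub[of z] by (simp add: z_def power_mult_distrib)
    moreover have zy: "(norm z)\<^sup>2 = (norm x)\<^sup>2 - 2 * t * (x \<bullet> v) + t\<^sup>2 * (norm v)\<^sup>2"
      "(norm y)\<^sup>2 = (norm x)\<^sup>2 + 2 * (x \<bullet> v) + (norm v)\<^sup>2"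
      using norm_add_scaleR_sq[of x "- t" v] norm_add_scaleR_sq[of x 1 v]
      by (simp_all add: z_def y)
    moreover
    have "(l / 2 * (norm z)\<^sup>2 - \<phi> z) + t * (l / 2 * (norm y)\<^sup>2 - \<phi> y) - (1 + t) * (l / 2 * (norm x)\<^sup>2 - \<phi> x)
        = t * (l / 2 * (norm v)\<^sup>2) + t\<^sup>2 * (l / 2 * (norm v)\<^sup>2) - \<phi> z - t * \<phi> y + (1 + t) * \<phi> x"
      unfolding zy by (simp add: field_simps power2_eq_square)
    ultimately have "\<phi> x - t * (g \<bullet> v) + \<mu> / 2 * t\<^sup>2 * (norm v)\<^sup>2
        \<le> t * (l / 2 * (norm v)\<^sup>2) + t\<^sup>2 * (l / 2 * (norm v)\<^sup>2) - t * \<phi> y + (1 + t) * \<phi> x"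
      by linarith
    then have "t * (\<phi> y - \<phi> x - g \<bullet> v - l / 2 * (norm v)\<^sup>2)
        \<le> t * (t * ((l - \<mu>) / 2 * (norm v)\<^sup>2))"
      by (simp add: algebra_simps power2_eq_square diff_divide_distrib)
    then show ?thesis
      using t by simp
  qed
  then have "\<phi> y - \<phi> x - g \<bullet> v - l / 2 * (norm v)\<^sup>2 \<le> 0"
    by (rule le_of_le_add_small_multiple)
  then show ?thesis
    by (simp add: v_def)
qed

text \<open>The quadratic lower model at \<open>x\<close> lies below \<open>\<phi>\<close>, and by
  the descent inequality the upper model at \<open>y\<close> lies above it. Comparing the two models
  at one point suffices; the best point yields the extra squared norm.\<close>

lemma interpolation_inequality:
  fixes \<phi> :: "'a::real_inner \<Rightarrow> real"
  assumes cvx: "convex_on UNIV (\<lambda>x. l / 2 * (norm x)\<^sup>2 - \<phi> x)" and "\<mu> < l"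
    and sub_x: "\<And>z. \<phi> x + g \<bullet> (z - x) + \<mu> / 2 * (norm (z - x))\<^sup>2 \<le> \<phi> z"
    and sub_y: "\<And>z. \<phi> y + h \<bullet> (z - y) + \<mu> / 2 * (norm (z - y))\<^sup>2 \<le> \<phi> z"
  shows "\<phi> x + g \<bullet> (y - x) + \<mu> / 2 * (norm (y - x))\<^sup>2
      + (norm (h - g - \<mu> *\<^sub>R (y - x)))\<^sup>2 / (2 * (l - \<mu>)) \<le> \<phi> y"
proof -
  define \<rho> where "\<rho> = l - \<mu>"
  define a where "a = y - x"
  define e where "e = h - g - \<mu> *\<^sub>R a"
  define t where "t = 1 / \<rho>"
  \<comment> \<open>the minimiser over \<open>z\<close> of the upper model at \<open>y\<close> minus the lower model at \<open>x\<close>\<close>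
  define z where "z = y - t *\<^sub>R e"
  have \<rho>: "\<rho> > 0" "t * \<rho> = 1"
    using assms(2) by (auto simp: \<rho>_def t_def)
  have l: "l = \<rho> + \<mu>" and h: "h = e + g + \<mu> *\<^sub>R a"
    by (simp_all add: \<rho>_def e_def)
  have zx: "z - x = a + (- t) *\<^sub>R e" and zy: "z - y = (- t) *\<^sub>R e"
    by (simp_all add: z_def a_def)
  have "\<phi> x + g \<bullet> (z - x) + \<mu> / 2 * (norm (z - x))\<^sup>2
      \<le> \<phi> y + h \<bullet> (z - y) + l / 2 * (norm (z - y))\<^sup>2"
    using sub_x[of z] descent_inequality[OF cvx sub_y, of z] by linarith
  then have "\<phi> x + (g \<bullet> a - t * (g \<bullet> e)) + \<mu> / 2 * ((norm a)\<^sup>2 - 2 * t * (a \<bullet> e) + t\<^sup>2 * (norm e)\<^sup>2)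
      \<le> \<phi> y - t * ((norm e)\<^sup>2 + g \<bullet> e + \<mu> * (a \<bullet> e)) + (\<rho> + \<mu>) / 2 * (t\<^sup>2 * (norm e)\<^sup>2)"
    unfolding zx zy norm_add_scaleR_sq h l
    by (simp add: inner_simps power_mult_distrib dot_square_norm)
  moreover have "\<rho> * t\<^sup>2 = t"
    using \<rho>(2) by (simp add: power2_eq_square mult.commute)
  then have "\<rho> * (t\<^sup>2 * (norm e)\<^sup>2) = t * (norm e)\<^sup>2"
    by (metis mult.assoc)
  ultimately have "\<phi> x + g \<bullet> a + \<mu> / 2 * (norm a)\<^sup>2 + t * (norm e)\<^sup>2 / 2 \<le> \<phi> y"
    by (simp add: field_simps)
  moreover have "t * (norm e)\<^sup>2 / 2 = (norm e)\<^sup>2 / (2 * (l - \<mu>))"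
    by (simp add: t_def \<rho>_def)
  ultimately show ?thesis
    unfolding a_def[symmetric] e_def[symmetric] by linarith
qed

lemma subdiff_interpolation:
  fixes f :: "'a::euclidean_space \<Rightarrow> ereal"
  assumes f: "f \<in> curv_class \<mu> (ereal l)" and "\<mu> < l"
    and g: "g \<in> subdiff \<mu> f x" and h: "h \<in> subdiff \<mu> f y"
    and fx: "f x = ereal r" and fy: "f y = ereal s"
  shows "r + g \<bullet> (y - x) + \<mu> / 2 * (norm (y - x))\<^sup>2
      + (norm (h - g - \<mu> *\<^sub>R (y - x)))\<^sup>2 / (2 * (l - \<mu>)) \<le> s"
proof -
  define \<phi> where "\<phi> = (\<lambda>z. real_of_ereal (f z))"
  have \<phi>: "f z = ereal (\<phi> z)" for z
    using f by (auto simp: curv_class_def \<phi>_def ereal_real)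
  have "convex_on UNIV (\<lambda>x. l / 2 * (norm x)\<^sup>2 - \<phi> x)"
    using f by (auto simp: curv_class_def \<phi>_def)
  from interpolation_inequality[OF this \<open>\<mu> < l\<close>
      subdiff_quadratic_lower_bound[OF f g \<phi> \<phi>] subdiff_quadratic_lower_bound[OF f h \<phi> \<phi>]]
  show ?thesis
    using \<phi>[of x] \<phi>[of y] fx fy by simp
qed

section \<open>Lower bounds for the gain in each regime\<close>

text \<open>The left side is the tangent at \<open>E = w * c\<close> of the convex function
  \<open>E\<^sup>2 / w\<close>. For \<open>c \<ge> 0\<close> it is monotone in \<open>E\<close>, so
  a lower bound on \<open>E\<close> can be inserted even where that bound is negative.\<close>

lemma quotient_above_tangent:
  fixes c E w :: real
  assumes "w > 0"
  shows "2 * c * E - w * c\<^sup>2 \<le> E\<^sup>2 / w"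
proof -
  have "0 \<le> (E - w * c)\<^sup>2"
    by simp
  then show ?thesis
    using assms by (simp add: field_simps power2_eq_square)
qed

lemma norm_shifted_ge:
  fixes a d :: "'a::real_normed_vector"
  assumes "0 \<le> \<beta>" "c \<le> norm d"
  shows "c - \<beta> * norm a \<le> norm (d - \<beta> *\<^sub>R a)"
  using norm_triangle_ineq2[of d "\<beta> *\<^sub>R a"] assms by simp

text \<open>The extremal configuration is \<open>A = m\<close>,
  \<open>E = (\<alpha> - \<beta>) * m\<close>. Linearising \<open>E\<^sup>2 / w\<close> there, with
  tangent parameter \<open>t * m\<close>, leaves a surplus with the factor
  \<open>A - m\<close>.\<close>

lemma gain_regime1:
  fixes a d :: "'a::real_inner"
  assumes "0 \<le> \<beta>" "\<beta> \<le> \<alpha>" "\<alpha> < l" "0 \<le> m" "m \<le> norm a" "\<alpha> * m \<le> norm d"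
  shows "(\<alpha> + \<beta> + (\<alpha> - \<beta>)\<^sup>2 / (l - \<beta>)) * m\<^sup>2
    \<le> (\<alpha> + \<beta>) * (norm a)\<^sup>2 + (norm (d - \<beta> *\<^sub>R a))\<^sup>2 / (l - \<beta>)"
proof -
  define A where "A = norm a"
  define E where "E = norm (d - \<beta> *\<^sub>R a)"
  define w where "w = l - \<beta>"
  define t where "t = (\<alpha> - \<beta>) / w"
  have w: "w > 0" and A: "m \<le> A"
    using assms by (auto simp: w_def A_def)
  have t: "0 \<le> t" "t \<le> 1" "w * t = \<alpha> - \<beta>"
    using assms w by (auto simp: t_def w_def)
  have p: "(\<alpha> - \<beta>)\<^sup>2 / w = t * (\<alpha> - \<beta>)"
    by (simp add: t_def power2_eq_square)
  have E: "\<alpha> * m - \<beta> * A \<le> E"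
    using norm_shifted_ge assms by (auto simp: A_def E_def)
  have "2 * (t * m) * (\<alpha> * m - \<beta> * A) - w * (t * m)\<^sup>2 \<le> E\<^sup>2 / w"
    using quotient_above_tangent[OF w, of "t * m" E]
      mult_left_mono[OF E, of "2 * (t * m)"] mult_nonneg_nonneg[OF t(1) assms(4)] by linarith
  moreover have "w * (t * m)\<^sup>2 = t * (\<alpha> - \<beta>) * m\<^sup>2"
    using t(3) by (metis (no_types, lifting) mult.assoc mult.commute power2_eq_square)
  moreover have "0 \<le> (A - m) * ((\<alpha> + \<beta>) * (A + m) - 2 * t * m * \<beta>)"
  proof -
    \<comment> \<open>\<open>t \<le> 1\<close> keeps the second factor nonnegative: it is at least
      \<open>2 * m * (\<alpha> + \<beta> - t * \<beta>)\<close>.\<close>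
    have "t * (m * \<beta>) \<le> 1 * (m * \<beta>)"
      using t assms by (intro mult_right_mono) auto
    moreover have "(\<alpha> + \<beta>) * (2 * m) \<le> (\<alpha> + \<beta>) * (A + m)"
      using assms A by (intro mult_left_mono) auto
    moreover have "0 \<le> \<alpha> * m"
      using assms by simp
    ultimately have "0 \<le> (\<alpha> + \<beta>) * (A + m) - 2 * t * m * \<beta>"
      by (simp add: algebra_simps)
    then show ?thesis
      using A by simp
  qed
  moreover have "(A - m) * ((\<alpha> + \<beta>) * (A + m) - 2 * t * m * \<beta>)
      = (\<alpha> + \<beta>) * A\<^sup>2 + (2 * (t * m) * (\<alpha> * m - \<beta> * A) - t * (\<alpha> - \<beta>) * m\<^sup>2)
        - (\<alpha> + \<beta> + t * (\<alpha> - \<beta>)) * m\<^sup>2"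
    by (simp add: algebra_simps power2_eq_square)
  ultimately show ?thesis
    unfolding A_def[symmetric] E_def[symmetric] w_def[symmetric] p by linarith
qed

text \<open>Expand \<open>d = e + \<beta> *\<^sub>R a\<close>. As \<open>\<beta> \<le> 0\<close>,
  cocoercivity bounds the cross term \<open>2 * \<beta> * (e \<bullet> a)\<close> from above by
  \<open>2 * \<beta> * q\<close>, which together with
  \<open>(norm e)\<^sup>2 = (l - \<beta>) * q\<close> gives
  \<open>(l + \<beta>) * q\<close>.\<close>

lemma gain_negative_curvature:
  fixes a d :: "'a::real_inner"
  assumes "\<beta> \<le> 0" "\<beta> < l" "0 \<le> \<alpha>" "0 \<le> m" "\<alpha> * m \<le> norm d"
    and coco: "(norm (d - \<beta> *\<^sub>R a))\<^sup>2 \<le> (l - \<beta>) * ((d - \<beta> *\<^sub>R a) \<bullet> a)"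
  shows "\<alpha>\<^sup>2 * m\<^sup>2 \<le> \<beta>\<^sup>2 * (norm a)\<^sup>2 + (l + \<beta>) * ((norm (d - \<beta> *\<^sub>R a))\<^sup>2 / (l - \<beta>))"
proof -
  define e where "e = d - \<beta> *\<^sub>R a"
  define q where "q = (norm e)\<^sup>2 / (l - \<beta>)"
  have d: "d = e + \<beta> *\<^sub>R a"
    by (simp add: e_def)
  have "(norm e)\<^sup>2 = (l - \<beta>) * q"
    using assms by (simp add: q_def)
  moreover have "q \<le> e \<bullet> a"
    using coco assms by (simp add: q_def e_def pos_divide_le_eq mult.commute)
  then have "2 * \<beta> * (e \<bullet> a) \<le> 2 * \<beta> * q"
    using assms by (intro mult_left_mono_neg) auto
  ultimately have "(norm d)\<^sup>2 \<le> \<beta>\<^sup>2 * (norm a)\<^sup>2 + (l + \<beta>) * q"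
    unfolding d norm_add_scaleR_sq by (simp add: algebra_simps)
  moreover have "(\<alpha> * m)\<^sup>2 \<le> (norm d)\<^sup>2"
    using assms by (intro power_mono) auto
  ultimately show ?thesis
    by (simp add: q_def e_def power_mult_distrib)
qed

text \<open>
  Below, \<open>A\<close> stands for \<open>norm a\<close> and \<open>q\<close> for \<open>(norm (d - \<beta> *\<^sub>R a))\<^sup>2 / (l - \<beta>)\<close>.  The threshold for
  \<open>\<beta>\<close> is the sign change of \<open>(\<alpha> + \<beta>) * (l + \<beta>) - \<beta>\<^sup>2\<close>, the slope in \<open>A\<^sup>2\<close> left once \<open>q\<close> is eliminated.
\<close>

lemma gain_regime3:
  fixes \<alpha> \<beta> l m A q :: real
  assumes "0 < \<alpha> + \<beta>" "\<alpha> < l" "- l * \<alpha> / (l + \<alpha>) \<le> \<beta>" "0 < \<alpha>" "0 \<le> m" "m \<le> A"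
    and low: "\<alpha>\<^sup>2 * m\<^sup>2 \<le> \<beta>\<^sup>2 * A\<^sup>2 + (l + \<beta>) * q"
  shows "(\<alpha> + \<beta>) * (l + \<alpha>) / (l + \<beta>) * m\<^sup>2 \<le> (\<alpha> + \<beta>) * A\<^sup>2 + q"
proof -
  have S: "0 < l + \<beta>"
    using assms by linarith
  \<comment> \<open>The right side equals \<open>l * \<alpha> + \<beta> * (l + \<alpha>)\<close>, so
    this is the threshold with its denominator cleared.\<close>
  have "0 \<le> (\<alpha> + \<beta>) * (l + \<beta>) - \<beta>\<^sup>2"
    using assms by (simp add: field_simps power2_eq_square)
  then have "((\<alpha> + \<beta>) * (l + \<beta>) - \<beta>\<^sup>2) * m\<^sup>2 \<le> ((\<alpha> + \<beta>) * (l + \<beta>) - \<beta>\<^sup>2) * A\<^sup>2"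
    using assms by (intro mult_left_mono power_mono) auto
  then have "(\<alpha> + \<beta>) * (l + \<alpha>) * m\<^sup>2 \<le> (l + \<beta>) * ((\<alpha> + \<beta>) * A\<^sup>2 + q)"
    using low by (simp add: algebra_simps power2_eq_square)
  then show ?thesis
    using S by (simp add: field_simps)
qed

text \<open>Below the threshold the slope changes sign, so \<open>A\<close> is eliminated instead of
  \<open>q\<close>: scale \<open>low\<close> by \<open>\<alpha> + \<beta>\<close> and bound the
  resulting coefficient of \<open>q\<close> by \<open>\<beta>\<^sup>2\<close>.\<close>

lemma gain_regime5:
  fixes \<alpha> \<beta> l m A q :: real
  assumes "0 < \<alpha> + \<beta>" "\<beta> < 0" "\<beta> < l" "\<beta> \<le> - l * \<alpha> / (l + \<alpha>)" "0 \<le> q"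
    and low: "\<alpha>\<^sup>2 * m\<^sup>2 \<le> \<beta>\<^sup>2 * A\<^sup>2 + (l + \<beta>) * q"
  shows "\<alpha>\<^sup>2 * (\<alpha> + \<beta>) / \<beta>\<^sup>2 * m\<^sup>2 \<le> (\<alpha> + \<beta>) * A\<^sup>2 + q"
proof -
  have "(\<alpha> + \<beta>) * (l + \<beta>) \<le> \<beta>\<^sup>2"
    using assms by (simp add: field_simps power2_eq_square)
  then have "((\<alpha> + \<beta>) * (l + \<beta>)) * q \<le> \<beta>\<^sup>2 * q"
    using assms by (intro mult_right_mono) auto
  moreover have "(\<alpha> + \<beta>) * (\<alpha>\<^sup>2 * m\<^sup>2) \<le> (\<alpha> + \<beta>) * (\<beta>\<^sup>2 * A\<^sup>2 + (l + \<beta>) * q)"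
    using low assms by (intro mult_left_mono) auto
  ultimately have "\<alpha>\<^sup>2 * (\<alpha> + \<beta>) * m\<^sup>2 \<le> \<beta>\<^sup>2 * ((\<alpha> + \<beta>) * A\<^sup>2 + q)"
    by (simp add: algebra_simps)
  then show ?thesis
    using assms by (simp add: pos_divide_le_eq mult.commute)
qed

text \<open>Cocoercivity forces \<open>norm d \<le> l * norm a\<close>, hence
  \<open>norm a \<ge> B\<close> with \<open>B = \<alpha> * m / l\<close>. Since
  \<open>l \<le> \<alpha>\<close>, this is at least as strong as \<open>norm a \<ge> m\<close>. The
  extremal configuration is \<open>A = B\<close>, \<open>E = w * B\<close>, with value
  \<open>(\<alpha> + \<beta> + w) * B\<^sup>2 = (l + \<alpha>) * B\<^sup>2\<close>.\<close>

lemma gain_regime4: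
  fixes a d :: "'a::real_inner"
  assumes "0 < l" "l \<le> \<alpha>" "\<beta> < l" "- l * \<alpha> / (l + \<alpha>) \<le> \<beta>" "0 \<le> m" "\<alpha> * m \<le> norm d"
    and coco: "(norm (d - \<beta> *\<^sub>R a))\<^sup>2 \<le> (l - \<beta>) * ((d - \<beta> *\<^sub>R a) \<bullet> a)"
  shows "\<alpha>\<^sup>2 * (l + \<alpha>) / l\<^sup>2 * m\<^sup>2
    \<le> (\<alpha> + \<beta>) * (norm a)\<^sup>2 + (norm (d - \<beta> *\<^sub>R a))\<^sup>2 / (l - \<beta>)"
proof -
  define A where "A = norm a"
  define E where "E = norm (d - \<beta> *\<^sub>R a)"
  define w where "w = l - \<beta>"
  define B where "B = \<alpha> * m / l"
  have w: "w > 0" and B: "0 \<le> B" and A: "0 \<le> A" and E0: "0 \<le> E" and Bl: "\<alpha> * m = l * B"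
    using assms by (auto simp: w_def B_def A_def E_def)
  have goal: "\<alpha>\<^sup>2 * (l + \<alpha>) / l\<^sup>2 * m\<^sup>2 = (l + \<alpha>) * B\<^sup>2"
    by (simp add: B_def power_mult_distrib power_divide)
  have "E\<^sup>2 \<le> w * (E * A)"
    using coco norm_cauchy_schwarz[of "d - \<beta> *\<^sub>R a" a] w
    by (smt (verit) A_def E_def w_def mult_left_mono)
  then have EA: "E \<le> w * A"
    using E0 A w by (cases "E = 0") (auto simp: power2_eq_square)
  have "(l + \<alpha>) * B\<^sup>2 \<le> (\<alpha> + \<beta>) * A\<^sup>2 + E\<^sup>2 / w"
  proof (cases "\<beta> < 0")
    case True
    define q where "q = E\<^sup>2 / w"
    have low: "(\<alpha> * m)\<^sup>2 \<le> \<beta>\<^sup>2 * A\<^sup>2 + (l + \<beta>) * q"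
      using gain_negative_curvature[OF _ _ _ _ _ coco] assms True
      by (simp add: A_def E_def w_def q_def power_mult_distrib)
    have thr: "0 \<le> (\<alpha> + \<beta>) * (l + \<beta>) - \<beta>\<^sup>2"
      using assms by (simp add: field_simps power2_eq_square)
    moreover have "0 < \<beta>\<^sup>2"
      using True by simp
    moreover have "0 < \<alpha> + \<beta>"
    proof -
      have "- (l * \<alpha>) \<le> \<beta> * (l + \<alpha>)"
        using assms by (simp add: field_simps)
      then have "- \<beta> * \<alpha> \<le> l * (\<alpha> + \<beta>)"
        by (simp add: algebra_simps)
      moreover have "0 < - \<beta> * \<alpha>"
        using True assms by (intro mult_pos_pos) auto
      ultimately have "0 < l * (\<alpha> + \<beta>)"
        by linarith
      then show ?thesis
        using assms by (simp add: zero_less_mult_iff)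
    qed
    ultimately have S: "0 < l + \<beta>"
      by (smt (verit) zero_less_mult_pos)
    have "E\<^sup>2 \<le> (w * A)\<^sup>2"
      using EA E0 by (intro power_mono)
    then have "q \<le> w * A\<^sup>2"
      using w by (simp add: q_def field_simps power2_eq_square)
    then have "(l + \<beta>) * q \<le> (l + \<beta>) * (w * A\<^sup>2)"
      using S by (intro mult_left_mono) auto
    \<comment> \<open>\<open>\<beta>\<^sup>2 + (l + \<beta>) * w = l\<^sup>2\<close>, since
      \<open>w = l - \<beta>\<close>.\<close>
    then have "(l * B)\<^sup>2 \<le> (l * A)\<^sup>2"
      using low unfolding Bl by (simp add: w_def algebra_simps power2_eq_square)
    then have "B\<^sup>2 \<le> A\<^sup>2"
      using assms by (simp add: power_mult_distrib)
    then have "((\<alpha> + \<beta>) * (l + \<beta>) - \<beta>\<^sup>2) * B\<^sup>2 \<le> ((\<alpha> + \<beta>) * (l + \<beta>) - \<beta>\<^sup>2) * A\<^sup>2"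
      using thr by (intro mult_left_mono)
    then have "(l + \<beta>) * ((l + \<alpha>) * B\<^sup>2) \<le> (l + \<beta>) * ((\<alpha> + \<beta>) * A\<^sup>2 + q)"
      using low unfolding Bl by (simp add: algebra_simps power2_eq_square)
    then show ?thesis
      using S by (simp add: q_def)
  next
    case False
    have E: "l * B - \<beta> * A \<le> E"
      using norm_shifted_ge[of \<beta> "\<alpha> * m" d a] assms False by (simp add: A_def E_def Bl)
    then have "l * B \<le> l * A"
      using EA by (simp add: w_def algebra_simps)
    then have BA: "B \<le> A"
      using assms by simp
    have "2 * B * (l * B - \<beta> * A) - w * B\<^sup>2 \<le> E\<^sup>2 / w"
      using quotient_above_tangent[OF w, of B E] mult_left_mono[OF E, of "2 * B"] B by linarith
    \<comment> \<open>This is the surplus left after replacing \<open>E\<^sup>2 / w\<close> by its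
      tangent at \<open>w * B\<close>.\<close>
    moreover have "0 \<le> \<alpha> * (A\<^sup>2 - B\<^sup>2) + \<beta> * (A - B)\<^sup>2"
      using False assms power_mono[OF BA B, of 2] by (intro add_nonneg_nonneg mult_nonneg_nonneg) auto
    ultimately show ?thesis
      by (simp add: w_def algebra_simps power2_eq_square)
  qed
  then show ?thesis
    unfolding goal by (simp add: A_def E_def w_def)
qed

section \<open>Infinite curvature and selection of the regime\<close>

lemma at_ext_ereal [simp]: "at_ext h (ereal l) = h l"
  by (simp add: at_ext_def)

lemma at_ext_infinity: "(h \<longlongrightarrow> c) at_top \<Longrightarrow> at_ext h \<infinity> = c"
  by (simp add: at_ext_def tendsto_Lim)

lemma dca_threshold_infinity: "dca_threshold \<mu> \<infinity> = - \<mu>"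
  unfolding dca_threshold_def by (rule at_ext_infinity) real_asymp

lemma dca_coeff_infinity:
  "dca_coeff 1 \<mu>1 L1 \<mu>2 \<infinity> = \<mu>1 + \<mu>2"
  "\<mu>1 + \<mu>2 > 0 \<Longrightarrow> dca_coeff 3 \<mu>1 L1 \<mu>2 \<infinity> = \<mu>1 + \<mu>2"
proof -
  show "dca_coeff 1 \<mu>1 L1 \<mu>2 \<infinity> = \<mu>1 + \<mu>2"
    unfolding dca_coeff_def by (simp, rule at_ext_infinity) real_asymp
  show "dca_coeff 3 \<mu>1 L1 \<mu>2 \<infinity> = \<mu>1 + \<mu>2" if "\<mu>1 + \<mu>2 > 0"
    unfolding dca_coeff_def using that by (simp, intro at_ext_infinity) real_asymp
qed

text \<open>Here \<open>D\<close> stands for twice the decrease of the objective. Interpolation and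
  cocoercivity are assumed only for finite \<open>LB\<close>; for \<open>LB = \<infinity>\<close>
  the bound \<open>D\<close> from strong convexity already matches the limiting coefficient
  \<open>\<alpha> + \<beta>\<close>. Nonnegativity of the coefficient later secures a positive
  denominator.\<close>

lemma dca_gain:
  fixes a d :: "'a::real_inner"
  assumes i: "i \<in> {1, 3, 4, 5}" and regime: "dca_regime i \<alpha> LA \<beta> LB"
    and "0 \<le> \<alpha>" "0 < \<alpha> + \<beta>" "ereal \<beta> < LB" "0 \<le> m" "m \<le> norm a" "\<alpha> * m \<le> norm d"
    and D: "(\<alpha> + \<beta>) * (norm a)\<^sup>2 \<le> D"
    and Dl: "\<And>l. LB = ereal l \<Longrightarrow>
      (\<alpha> + \<beta>) * (norm a)\<^sup>2 + (norm (d - \<beta> *\<^sub>R a))\<^sup>2 / (l - \<beta>) \<le> D"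
    and coco: "\<And>l. LB = ereal l \<Longrightarrow>
      (norm (d - \<beta> *\<^sub>R a))\<^sup>2 \<le> (l - \<beta>) * ((d - \<beta> *\<^sub>R a) \<bullet> a)"
  shows "0 \<le> dca_coeff i \<alpha> LA \<beta> LB \<and> dca_coeff i \<alpha> LA \<beta> LB * m\<^sup>2 \<le> D"
proof (cases LB)
  case PInf
  \<comment> \<open>The threshold is now \<open>-\<alpha>\<close>, so regime 5 is empty, and regime
    4 requires a finite \<open>LB\<close>.\<close>
  have i13: "i = 1 \<or> i = 3"
    using i regime assms(4) unfolding dca_regime_def PInf
    by (auto simp: dca_threshold_infinity)
  then have c: "dca_coeff i \<alpha> LA \<beta> LB = \<alpha> + \<beta>"
    using dca_coeff_infinity assms(4) PInf by auto
  have "(\<alpha> + \<beta>) * m\<^sup>2 \<le> (\<alpha> + \<beta>) * (norm a)\<^sup>2"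
    using assms by (intro mult_left_mono power_mono) auto
  then have "(\<alpha> + \<beta>) * m\<^sup>2 \<le> D"
    using D by (rule order_trans)
  then show ?thesis
    unfolding c using assms(4) by simp
next
  case MInf
  then show ?thesis
    using assms(5) by simp
next
  case (real l)
  have \<beta>l: "\<beta> < l" and l: "0 < l + \<alpha>"
    using assms real by auto
  define q where "q = (norm (d - \<beta> *\<^sub>R a))\<^sup>2 / (l - \<beta>)"
  have q: "0 \<le> q" "(\<alpha> + \<beta>) * (norm a)\<^sup>2 + q \<le> D"
    using Dl[OF real] \<beta>l by (auto simp: q_def)
  have low: "\<alpha>\<^sup>2 * m\<^sup>2 \<le> \<beta>\<^sup>2 * (norm a)\<^sup>2 + (l + \<beta>) * q" if "\<beta> < 0"
    unfolding q_def using that assms \<beta>l coco[OF real] by (intro gain_negative_curvature) auto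
  consider "i = 1" | "i = 3" | "i = 4" | "i = 5"
    using i by auto
  then show ?thesis
  proof cases
    case 1
    then have r: "0 \<le> \<beta>" "\<beta> \<le> \<alpha>" "\<alpha> < l"
      using regime real by (auto simp: dca_regime_def)
    have c: "dca_coeff i \<alpha> LA \<beta> LB = \<alpha> + \<beta> + (\<alpha> - \<beta>)\<^sup>2 / (l - \<beta>)"
      using 1 real by (simp add: dca_coeff_def)
    show ?thesis
      unfolding c using gain_regime1[OF r assms(6-8)] q r by (auto simp: q_def)
  next
    case 2
    then have r: "- l * \<alpha> / (l + \<alpha>) \<le> \<beta>" "\<beta> < 0" "\<alpha> < l" "0 < \<alpha>"
      using regime real by (auto simp: dca_regime_def dca_threshold_def)
    have c: "dca_coeff i \<alpha> LA \<beta> LB = (\<alpha> + \<beta>) * (l + \<alpha>) / (l + \<beta>)"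
      using 2 real by (simp add: dca_coeff_def)
    show ?thesis
      unfolding c using gain_regime3[OF assms(4) r(3,1,4) assms(6,7) low[OF r(2)]] q r assms(4) by auto
  next
    case 3
    then have r: "- l * \<alpha> / (l + \<alpha>) \<le> \<beta>" "0 \<le> l" "l \<le> \<alpha>"
      using regime real by (auto simp: dca_regime_def dca_threshold_def)
    \<comment> \<open>At \<open>l = 0\<close> the threshold is 0, contradicting
      \<open>\<beta> < l\<close>.\<close>
    then have "0 < l"
      using \<beta>l by (cases "l = 0") auto
    have c: "dca_coeff i \<alpha> LA \<beta> LB = \<alpha>\<^sup>2 * (l + \<alpha>) / l\<^sup>2"
      using 3 real by (simp add: dca_coeff_def)
    show ?thesis
      unfolding c using gain_regime4[OF \<open>0 < l\<close> r(3) \<beta>l r(1) assms(6,8) coco[OF real]] q r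
      by (auto simp: q_def)
  next
    case 4
    then have r: "\<beta> \<le> - l * \<alpha> / (l + \<alpha>)" "\<beta> < 0"
      using regime real by (auto simp: dca_regime_def dca_threshold_def)
    have c: "dca_coeff i \<alpha> LA \<beta> LB = \<alpha>\<^sup>2 * (\<alpha> + \<beta>) / \<beta>\<^sup>2"
      using 4 real by (simp add: dca_coeff_def)
    show ?thesis
      unfolding c using gain_regime5[OF assms(4) r(2) \<beta>l r(1) q(1) low[OF r(2)]] q assms(4) by auto
  qed
qed

section \<open>Decrease of the objective over a step\<close>

text \<open>Add the bound for \<open>p\<close> from \<open>v\<close> to \<open>u\<close> and the
  bound for \<open>q\<close> from \<open>u\<close> to \<open>v\<close>: the common subgradient
  \<open>g\<close> makes the linear terms cancel.\<close>

lemma dc_single_decrease: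
  fixes p q :: "'a::euclidean_space \<Rightarrow> ereal"
  assumes p: "p \<in> curv_class \<alpha> LA" and q: "q \<in> curv_class \<beta> LB"
    and g: "g \<in> subdiff \<beta> q u" "g \<in> subdiff \<alpha> p v"
    and vals: "p u = ereal pu" "q u = ereal qu" "p v = ereal pv" "q v = ereal qv"
  shows "(\<alpha> + \<beta>) * (norm (v - u))\<^sup>2 \<le> 2 * ((pu - qu) - (pv - qv))"
  using subdiff_quadratic_lower_bound[OF p g(2) vals(3,1)]
    subdiff_quadratic_lower_bound[OF q g(1) vals(2,4)]
  by (simp add: norm_minus_commute inner_simps algebra_simps)

text \<open>
  Stated for \<open>p\<close> and \<open>q\<close> so that it serves both pairings: \<open>u, v, w\<close> are consecutive iterates in
  this order if \<open>(p, q) = (f1, f2)\<close> and in reverse order if \<open>(p, q) = (f2, f1)\<close>.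
\<close>

lemma dc_pair_decrease:
  fixes p q :: "'a::euclidean_space \<Rightarrow> ereal"
  assumes p: "p \<in> curv_class \<alpha> LA" and q: "q \<in> curv_class \<beta> LB"
    and g: "g \<in> subdiff \<beta> q u" "g \<in> subdiff \<alpha> p v"
    and h: "h \<in> subdiff \<beta> q v" "h \<in> subdiff \<alpha> p w"
    and vals: "p u = ereal pu" "q u = ereal qu" "p v = ereal pv" "q v = ereal qv"
    and i: "i \<in> {1, 3, 4, 5}" "dca_regime i \<alpha> LA \<beta> LB"
    and par: "0 \<le> \<alpha>" "0 < \<alpha> + \<beta>" "ereal \<beta> < LB"
    and m: "0 \<le> m" "m \<le> norm (v - u)" "m \<le> norm (w - v)"
  shows "0 \<le> dca_coeff i \<alpha> LA \<beta> LB \<and>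
    dca_coeff i \<alpha> LA \<beta> LB * m\<^sup>2 \<le> 2 * ((pu - qu) - (pv - qv))"
proof (rule dca_gain[OF i par m(1,2)])
  define b where "b = w - v"
  \<comment> \<open>The neighbouring step \<open>b\<close> enters only through this lower bound on
    \<open>norm (h - g)\<close>.\<close>
  have "\<alpha> * (norm b)\<^sup>2 \<le> (h - g) \<bullet> b"
    using subdiff_strongly_monotone[OF p g(2) h(2)] by (simp add: b_def)
  also have "\<dots> \<le> norm (h - g) * norm b"
    by (rule norm_cauchy_schwarz)
  finally have "\<alpha> * norm b \<le> norm (h - g)"
    by (cases "b = 0") (auto simp: power2_eq_square)
  moreover have "\<alpha> * m \<le> \<alpha> * norm b"
    using par m by (intro mult_left_mono) (auto simp: b_def)
  ultimately show "\<alpha> * m \<le> norm (h - g)"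
    by linarith
  show "(\<alpha> + \<beta>) * (norm (v - u))\<^sup>2 \<le> 2 * ((pu - qu) - (pv - qv))"
    by (rule dc_single_decrease[OF p q g vals])
next
  fix l assume l: "LB = ereal l"
  then have q': "q \<in> curv_class \<beta> (ereal l)" and "\<beta> < l"
    using q par by auto
  define a where "a = v - u"
  define e where "e = h - g - \<beta> *\<^sub>R a"
  define Q where "Q = (norm e)\<^sup>2 / (l - \<beta>)"
  have hg: "h = g + e + \<beta> *\<^sub>R a"
    by (simp add: e_def)
  have flip: "u - v = - a" "g - h - \<beta> *\<^sub>R (- a) = - e"
    by (simp_all add: a_def e_def algebra_simps)
  have Q2: "(norm e)\<^sup>2 / (2 * (l - \<beta>)) = Q / 2"
    by (simp add: Q_def)
  \<comment> \<open>Facts 1 and 3 add up to the decrease, facts 1 and 2 to cocoercivity.\<close>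
  have 1: "qu + g \<bullet> a + \<beta> / 2 * (norm a)\<^sup>2 + Q / 2 \<le> qv"
    using subdiff_interpolation[OF q' \<open>\<beta> < l\<close> g(1) h(1) vals(2,4)]
    unfolding a_def[symmetric] e_def[symmetric] Q2 .
  have 2: "qv - h \<bullet> a + \<beta> / 2 * (norm a)\<^sup>2 + Q / 2 \<le> qu"
    using subdiff_interpolation[OF q' \<open>\<beta> < l\<close> h(1) g(1) vals(4,2)]
    unfolding flip norm_minus_cancel inner_minus_right Q2 by simp
  have 3: "pv - g \<bullet> a + \<alpha> / 2 * (norm a)\<^sup>2 \<le> pu"
    using subdiff_quadratic_lower_bound[OF p g(2) vals(3,1)] by (simp add: flip)
  show "(\<alpha> + \<beta>) * (norm (v - u))\<^sup>2 + (norm (h - g - \<beta> *\<^sub>R (v - u)))\<^sup>2 / (l - \<beta>)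
      \<le> 2 * ((pu - qu) - (pv - qv))"
    unfolding a_def[symmetric] e_def[symmetric] Q_def[symmetric]
    using 1 3 by (simp add: algebra_simps)
  have "Q \<le> e \<bullet> a"
    using 1 2 unfolding hg by (simp add: inner_simps dot_square_norm algebra_simps)
  then show "(norm (h - g - \<beta> *\<^sub>R (v - u)))\<^sup>2 \<le> (l - \<beta>) * ((h - g - \<beta> *\<^sub>R (v - u)) \<bullet> (v - u))"
    unfolding a_def[symmetric] e_def[symmetric]
    using \<open>\<beta> < l\<close> by (simp add: Q_def pos_divide_le_eq mult.commute)
qed

section \<open>DCA steps, exchange of roles and summation\<close>

text \<open>Minimality of \<open>x'\<close> is the subgradient inequality of \<open>f1\<close> at
  \<open>x'\<close>, so one vector is a subgradient of \<open>f2\<close> at the old and of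
  \<open>f1\<close> at the new iterate.\<close>

lemma dca_step_subgradient:
  fixes f1 f2 :: "'a::euclidean_space \<Rightarrow> ereal"
  assumes f1: "f1 \<in> curv_class \<mu>1 L1" and "0 \<le> \<mu>1" and step: "dca_step f1 \<mu>2 f2 x x'"
  obtains g where "g \<in> subdiff \<mu>2 f2 x" "g \<in> subdiff \<mu>1 f1 x'"
proof -
  obtain g where g: "g \<in> subdiff \<mu>2 f2 x"
    and min: "f1 x' - ereal (g \<bullet> x') \<le> f1 y - ereal (g \<bullet> y)" for y
    using step by (auto simp: dca_step_def is_arg_min_def not_less)
  have "f1 x' + ereal (g \<bullet> (y - x')) \<le> f1 y" for y
    using min[of y] by (cases "f1 x'"; cases "f1 y") (auto simp: inner_simps)
  then have "g \<in> subdiff \<mu>1 f1 x'"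
    using \<open>0 \<le> \<mu>1\<close> by (simp add: subdiff_def convex_subdiff_def)
  with g show thesis
    by (rule that)
qed

lemma sum_decrease_lower_bound:
  fixes F :: "nat \<Rightarrow> real"
  assumes "\<And>k. k < n \<Longrightarrow> c \<le> F k - F (Suc k)"
  shows "real n * c \<le> F 0 - F n"
proof -
  have "(\<Sum>k<n. c) \<le> (\<Sum>k<n. F k - F (Suc k))"
    using assms by (intro sum_mono) auto
  then show ?thesis
    by (simp add: sum_lessThan_telescope')
qed

lemma dca_regime_swap:
  assumes "0 \<le> \<mu>1" "ereal \<mu>1 < L1"
  shows "dca_regime 2 \<mu>1 L1 \<mu>2 L2 \<Longrightarrow> dca_regime 1 \<mu>2 L2 \<mu>1 L1"
    and "dca_regime 6 \<mu>1 L1 \<mu>2 L2 \<Longrightarrow> dca_regime 4 \<mu>2 L2 \<mu>1 L1"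
proof -
  show "dca_regime 2 \<mu>1 L1 \<mu>2 L2 \<Longrightarrow> dca_regime 1 \<mu>2 L2 \<mu>1 L1"
    by (simp add: dca_regime_def)
  assume "dca_regime 6 \<mu>1 L1 \<mu>2 L2"
  then have r: "\<mu>2 \<ge> \<mu>1" "0 < L1" "L1 \<le> ereal \<mu>2"
    by (simp_all add: dca_regime_def)
  then obtain l where l: "L1 = ereal l" "0 < l" "l \<le> \<mu>2"
    by (cases L1) auto
  \<comment> \<open>Regime 4 with exchanged roles needs the threshold below \<open>\<mu>1\<close>,
    and \<open>\<mu>1 \<ge> 0\<close>.\<close>
  then have "dca_threshold \<mu>2 L1 \<le> 0"
    by (simp add: dca_threshold_def)
  then show "dca_regime 4 \<mu>2 L2 \<mu>1 L1"
    using assms r by (simp add: dca_regime_def)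
qed

lemma dca_coeff_swap:
  "dca_coeff 2 \<mu>1 L1 \<mu>2 L2 = dca_coeff 1 \<mu>2 L2 \<mu>1 L1"
  "dca_coeff 6 \<mu>1 L1 \<mu>2 L2 = dca_coeff 4 \<mu>2 L2 \<mu>1 L1"
  by (simp_all add: dca_coeff_def add.commute power2_commute)

theorem theorem1:
  fixes f1 f2 :: "'a::euclidean_space \<Rightarrow> ereal"
    and \<mu>1 \<mu>2 :: real and L1 L2 :: ereal
    and N :: nat and x :: "nat \<Rightarrow> 'a"
  assumes "dc_standing \<mu>1 L1 \<mu>2 L2 f1 f2"
    and "\<mu>1 + \<mu>2 > 0"
    and "N \<ge> 1"
    and "x 0 \<in> dom_subdiff \<mu>1 f1"
    and "\<And>k. k \<le> N \<Longrightarrow> dca_step f1 \<mu>2 f2 (x k) (x (Suc k))"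
  shows "\<forall>i\<in>{1..6}. dca_regime i \<mu>1 L1 \<mu>2 L2 \<longrightarrow>
           ereal (1 / 2 * (MIN k\<in>{0..N}. (norm (x k - x (Suc k)))\<^sup>2))
             \<le> (dc_obj f1 f2 (x 0) - dc_obj f1 f2 (x (N + 1)))
                 / ereal ((\<mu>1 + \<mu>2) + dca_coeff i \<mu>1 L1 \<mu>2 L2 * real N)"
proof (intro ballI impI)
  fix i :: nat
  assume i: "i \<in> {1..6}" and regime: "dca_regime i \<mu>1 L1 \<mu>2 L2"
  have par: "0 \<le> \<mu>1" "ereal \<mu>1 < L1" "ereal \<mu>2 < L2"
    and f1: "f1 \<in> curv_class \<mu>1 L1" and f2: "f2 \<in> curv_class \<mu>2 L2"
    and dom: "dom_subdiff \<mu>1 f1 \<subseteq> dom_subdiff \<mu>2 f2"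
    using assms(1) by (auto simp: dc_standing_def)
  have "\<exists>g. g \<in> subdiff \<mu>2 f2 (x k) \<and> g \<in> subdiff \<mu>1 f1 (x (Suc k))" if "k \<le> N" for k
    using dca_step_subgradient[OF f1 par(1) assms(5)[OF that]] by blast
  then obtain g where g2: "\<And>k. k \<le> N \<Longrightarrow> g k \<in> subdiff \<mu>2 f2 (x k)"
    and g1: "\<And>k. k \<le> N \<Longrightarrow> g k \<in> subdiff \<mu>1 f1 (x (Suc k))"
    by metis
  define \<phi>1 where "\<phi>1 = (\<lambda>k. real_of_ereal (f1 (x k)))"
  define \<phi>2 where "\<phi>2 = (\<lambda>k. real_of_ereal (f2 (x k)))"
  define F where "F = (\<lambda>k. \<phi>1 k - \<phi>2 k)"
  \<comment> \<open>The start is in the domain by assumption, each later iterate by the subgradient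
    of the step leading to it; this includes the last one, where no further step is taken.\<close>
  have x_dom: "x k \<in> dom_subdiff \<mu>1 f1" if "k \<le> Suc N" for k
    using that assms(4) g1 by (cases k) (auto simp: dom_subdiff_def)
  have \<phi>1: "f1 (x k) = ereal (\<phi>1 k)" and \<phi>2: "f2 (x k) = ereal (\<phi>2 k)" if k: "k \<le> Suc N" for k
  proof -
    obtain g1 g2 where "g1 \<in> subdiff \<mu>1 f1 (x k)" "g2 \<in> subdiff \<mu>2 f2 (x k)"
      using subsetD[OF dom x_dom[OF k]] x_dom[OF k] unfolding dom_subdiff_def by blast
    then have "\<bar>f1 (x k)\<bar> \<noteq> \<infinity>" "\<bar>f2 (x k)\<bar> \<noteq> \<infinity>"
      using subdiff_finite[OF f1] subdiff_finite[OF f2] by simp_all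
    then show "f1 (x k) = ereal (\<phi>1 k)" "f2 (x k) = ereal (\<phi>2 k)"
      by (auto simp: \<phi>1_def \<phi>2_def ereal_real)
  qed
  define M where "M = (MIN k\<in>{0..N}. (norm (x k - x (Suc k)))\<^sup>2)"
  define m where "m = sqrt M"
  have M_le: "M \<le> (norm (x k - x (Suc k)))\<^sup>2" if "k \<le> N" for k
    using that by (auto simp: M_def intro: Min_le)
  have "0 \<le> M"
    by (auto simp: M_def)
  then have m: "0 \<le> m" "m\<^sup>2 = M"
    by (auto simp: m_def)
  have m_le: "m \<le> norm (x (Suc k) - x k)" "m \<le> norm (x k - x (Suc k))" if "k \<le> N" for k
    using M_le[OF that] by (auto simp: m_def norm_minus_commute intro: real_le_lsqrt)
  define p where "p = dca_coeff i \<mu>1 L1 \<mu>2 L2"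
  have single: "(\<mu>1 + \<mu>2) * M \<le> 2 * (F k - F (Suc k))" if "k \<le> N" for k
  proof -
    have "(\<mu>1 + \<mu>2) * M \<le> (\<mu>1 + \<mu>2) * (norm (x (Suc k) - x k))\<^sup>2"
      using assms(2) M_le[OF that] by (intro mult_left_mono) (auto simp: norm_minus_commute)
    also have "\<dots> \<le> 2 * (F k - F (Suc k))"
      unfolding F_def using that
      by (intro dc_single_decrease[OF f1 f2 g2 g1] \<phi>1 \<phi>2) auto
    finally show ?thesis .
  qed
  have "0 \<le> p \<and> (\<mu>1 + \<mu>2 + p * real N) * M \<le> 2 * (F 0 - F (Suc N))"
  proof (cases "i \<in> {2, 6}")
    case True
    then have "\<mu>1 \<le> \<mu>2"
      using regime by (auto simp: dca_regime_def)
    with par(1) have "0 \<le> \<mu>2"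
      by simp
    define j where "j = (if i = 2 then 1 else 4 :: nat)"
    have j: "j \<in> {1, 3, 4, 5}" "dca_regime j \<mu>2 L2 \<mu>1 L1" "p = dca_coeff j \<mu>2 L2 \<mu>1 L1"
      using True dca_regime_swap[OF par(1,2), of \<mu>2 L2] dca_coeff_swap[of \<mu>1 L1 \<mu>2 L2] regime
      unfolding p_def j_def by (cases "i = 2"; simp)+
    \<comment> \<open>The triple is read backwards as \<open>x (Suc (Suc k))\<close>,
      \<open>x (Suc k)\<close>, \<open>x k\<close>, so the gain belongs to the step leaving
      \<open>x (Suc k)\<close>. Steps 1 to \<open>N\<close> are covered, and step 0 gets only the
      \<open>single\<close> bound.\<close>
    have pair: "0 \<le> p \<and> p * m\<^sup>2 \<le> 2 * ((\<phi>2 (Suc (Suc k)) - \<phi>1 (Suc (Suc k))) - (\<phi>2 (Suc k) - \<phi>1 (Suc k)))"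
      if "k < N" for k
      unfolding j(3) using that assms(2) par \<open>0 \<le> \<mu>2\<close> m(1)
      by (intro dc_pair_decrease[OF f2 f1 g1[of "Suc k"] g2[of "Suc k"] g1[of k] g2[of k]]
          \<phi>1 \<phi>2 j m_le) simp_all
    have "real N * (p * M / 2) \<le> F (Suc 0) - F (Suc N)"
      using sum_decrease_lower_bound[of N "p * M / 2" "\<lambda>k. F (Suc k)"] pair
      unfolding F_def m(2) by fastforce
    then show ?thesis
      using single[of 0] pair[of 0] assms(3) by (simp add: algebra_simps)
  next
    case False
    then have "i \<in> {1, 3, 4, 5}"
      using i by auto
    \<comment> \<open>Here the gain belongs to the step leaving \<open>x k\<close>, so steps 0 to
      \<open>N - 1\<close> are covered and step \<open>N\<close> gets the \<open>single\<close>
      bound. As \<open>N \<ge> 1\<close>, the instance \<open>k = 0\<close> below supplies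
      \<open>0 \<le> p\<close>.\<close>
    have pair: "0 \<le> p \<and> p * m\<^sup>2 \<le> 2 * ((\<phi>1 k - \<phi>2 k) - (\<phi>1 (Suc k) - \<phi>2 (Suc k)))"
      if "k < N" for k
      unfolding p_def using that assms(2) par m(1)
      by (intro dc_pair_decrease[OF f1 f2 g2[of k] g1[of k] g2[of "Suc k"] g1[of "Suc k"]]
          \<phi>1 \<phi>2 \<open>i \<in> {1, 3, 4, 5}\<close> regime m_le) simp_all
    have "real N * (p * M / 2) \<le> F 0 - F N"
      using sum_decrease_lower_bound[of N "p * M / 2" F] pair
      unfolding F_def m(2) by fastforce
    then show ?thesis
      using single[of N] pair[of 0] assms(3) by (simp add: algebra_simps)
  qed
  moreover from this have pos: "0 < \<mu>1 + \<mu>2 + p * real N"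
    using assms(2) by (simp add: add_pos_nonneg)
  ultimately have "1 / 2 * M \<le> (F 0 - F (Suc N)) / (\<mu>1 + \<mu>2 + p * real N)"
    by (simp add: pos_le_divide_eq mult.commute)
  moreover have "dc_obj f1 f2 (x k) = ereal (F k)" if "k \<le> Suc N" for k
    using \<phi>1[OF that] \<phi>2[OF that] by (simp add: dc_obj_def F_def)
  ultimately show "ereal (1 / 2 * (MIN k\<in>{0..N}. (norm (x k - x (Suc k)))\<^sup>2))
      \<le> (dc_obj f1 f2 (x 0) - dc_obj f1 f2 (x (N + 1)))
        / ereal ((\<mu>1 + \<mu>2) + dca_coeff i \<mu>1 L1 \<mu>2 L2 * real N)"
    using pos by (simp add: M_def[symmetric] p_def[symmetric])
qed

end
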